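(* Let $(Q,\diamond)$ be a rack and let $\mathcal{A}:Q\rightarrow Q$ be an averaging operator on $Q$. (i) For each $k\geq 0$, the map $\mathcal{A}^k:Q\rightarrow Q$ is an averaging operator on $Q$. (ii) For any $k,l\geq 0$, the map $\mathcal{A}^k:Q\rightarrow Q$ is an averaging operator on the descendent rack $(Q,\diamond_{\mathcal{A}^l})$. (iii) For any $k,l\geq 0$, the descendent racks $(Q,\diamond_{\mathcal{A}^{k+l}})$ and $(Q,(\diamond_{\mathcal{A}^l})_{\mathcal{A}^k})$ are the same.
   Context: A (left) rack $(Q,\diamond)$ is a nonempty set $Q$ with a binary operation $\diamond$ such that $x\diamond(y\diamond z) = (x\diamond y)\diamond(x\diamond z)$ for all $x,y,z\in Q$, and for any $x,y\in Q$ there is a unique $c\in Q$ with $x\diamond c = y$. An averaging operator on a rack $(Q,\diamond)$ is a map $\mathcal{A}:Q\to Q$ satisfying $\mathcal{A}(x)\diamond\mathcal{A}(y) = \mathcal{A}(\mathcal{A}(x)\diamond y)$ for all $x,y\in Q$. Given an averaging operator $\mathcal{B}$ on a rack $(Q,\ast)$, the descendent rack is $(Q,\ast_{\mathcal{B}})$ with $x\ast_{\mathcal{B}}y := \mathcal{B}(x)\ast y$ (this is again a rack). $\mathcal{A}^k$ denotes the $k$-fold composition of $\mathcal{A}$, with $\mathcal{A}^0=\mathrm{Id}$. In (iii), $(\diamond_{\mathcal{A}^l})_{\mathcal{A}^k}$ is the descendent operation obtained from the rack $(Q,\diamond_{\mathcal{A}^l})$ and its averaging operator $\mathcal{A}^k$.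 *)

theory Defs
  imports Main
begin

locale rack =
  fixes Q :: "'a set" and opn :: "'a \<Rightarrow> 'a \<Rightarrow> 'a"  (infixl "\<diamondop>" 70)
  assumes nonempty: "Q \<noteq> {}"
    and closed: "\<lbrakk>x \<in> Q; y \<in> Q\<rbrakk> \<Longrightarrow> x \<diamondop> y \<in> Q"
    and self_distrib: "\<lbrakk>x \<in> Q; y \<in> Q; z \<in> Q\<rbrakk> \<Longrightarrow> x \<diamondop> (y \<diamondop> z) = (x \<diamondop> y) \<diamondop> (x \<diamondop> z)"
    and unique_solution: "\<lbrakk>x \<in> Q; y \<in> Q\<rbrakk> \<Longrightarrow> \<exists>!c. c \<in> Q \<and> x \<diamondop> c = y"

text \<open>The locale predicate \<open>averaging_operator Q opn A\<close> also asserts that \<open>(Q, opn)\<close> is a rack.\<close>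

locale averaging_operator = rack Q opn
  for Q :: "'a set" and opn :: "'a \<Rightarrow> 'a \<Rightarrow> 'a"  (infixl "\<diamondop>" 70) +
  fixes A :: "'a \<Rightarrow> 'a"
  assumes maps_to: "x \<in> Q \<Longrightarrow> A x \<in> Q"
    and averaging: "\<lbrakk>x \<in> Q; y \<in> Q\<rbrakk> \<Longrightarrow> A x \<diamondop> A y = A (A x \<diamondop> y)"

definition descendent :: "('a \<Rightarrow> 'a \<Rightarrow> 'a) \<Rightarrow> ('a \<Rightarrow> 'a) \<Rightarrow> 'a \<Rightarrow> 'a \<Rightarrow> 'a" where
  "descendent opn B x y = opn (B x) y"

text \<open>Two racks are the same if they have the same carrier and their operations agree on it;
  values of the operations outside the carrier are irrelevant.\<close>

definition same_rack :: "'a set \<Rightarrow> ('a \<Rightarrow> 'a \<Rightarrow> 'a) \<Rightarrow> 'a set \<Rightarrow> ('a \<Rightarrow> 'a \<Rightarrow> 'a) \<Rightarrow> bool" where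
  "same_rack Q f R g \<longleftrightarrow> rack Q f \<and> rack R g \<and> Q = R \<and> (\<forall>x\<in>Q. \<forall>y\<in>Q. f x y = g x y)"

end

theory Submission
  imports Defs
begin

text \<open>The averaging identity says that left translation by any element of the image of \<open>A\<close>
  commutes with \<open>A\<close>. Hence for \<open>n > 0\<close> left translation by \<open>A\<^sup>n x\<close> commutes with every power
  of \<open>A\<close>, which is the averaging identity for \<open>A\<^sup>k\<close> on \<open>Q\<close> (with \<open>n = k\<close>) and on the
  descendent rack of \<open>A\<^sup>l\<close> (with \<open>n = k + l\<close>); the case \<open>k = 0\<close> is trivial.\<close>

context averaging_operator
begin

lemma funpow_maps_to: "x \<in> Q \<Longrightarrow> (A ^^ n) x \<in> Q"
  by (induction n) (auto simp: maps_to)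

lemma funpow_averaging:
  assumes "x \<in> Q" "y \<in> Q" "0 < n"
  shows "(A ^^ n) x \<diamondop> (A ^^ m) y = (A ^^ m) ((A ^^ n) x \<diamondop> y)"
proof (induction m)
  case 0
  show ?case by simp
next
  case (Suc m)
  \<comment> \<open>Positivity of \<open>n\<close> exposes an outermost \<open>A\<close> on the left
    factor, so \<open>averaging\<close> at \<open>(A ^^ j) x\<close> and \<open>(A ^^ m) y\<close>
    pulls one \<open>A\<close> out of the product.\<close>
  obtain j where "n = Suc j"
    using assms(3) gr0_implies_Suc by blast
  then show ?case
    using Suc averaging[OF funpow_maps_to funpow_maps_to, OF assms(1,2), of j m] by simp
qed

lemma averaging_operator_funpow: "averaging_operator Q (\<diamondop>) (A ^^ k)"
proof unfold_locales
  fix x y assume "x \<in> Q" "y \<in> Q"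
  then show "(A ^^ k) x \<diamondop> (A ^^ k) y = (A ^^ k) ((A ^^ k) x \<diamondop> y)"
    by (cases k) (simp, metis funpow_averaging zero_less_Suc)
qed (rule funpow_maps_to)

text \<open>Self-distributivity at \<open>A x\<close>, \<open>A y\<close>, \<open>z\<close> produces
  the left factor \<open>A x \<diamondop> A y\<close>, which averaging identifies with
  \<open>A (A x \<diamondop> y)\<close>. Unique solvability is that of the original rack at
  \<open>A x\<close>.\<close>

lemma rack_descendent: "rack Q (descendent (\<diamondop>) A)"
proof
  fix x y z assume "x \<in> Q" "y \<in> Q" "z \<in> Q"
  then show "descendent (\<diamondop>) A x (descendent (\<diamondop>) A y z)
      = descendent (\<diamondop>) A (descendent (\<diamondop>) A x y) (descendent (\<diamondop>) A x z)"
    by (simp add: descendent_def self_distrib maps_to flip: averaging)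
next
  fix x y assume "x \<in> Q" "y \<in> Q"
  then show "\<exists>!c. c \<in> Q \<and> descendent (\<diamondop>) A x c = y"
    unfolding descendent_def by (intro unique_solution maps_to)
qed (simp_all add: descendent_def nonempty closed maps_to)

lemma averaging_operator_descendent_funpow:
  "averaging_operator Q (descendent (\<diamondop>) (A ^^ l)) (A ^^ k)"
proof (intro averaging_operator.intro averaging_operator_axioms.intro)
  show "rack Q (descendent (\<diamondop>) (A ^^ l))"
    by (rule averaging_operator.rack_descendent[OF averaging_operator_funpow])
next
  fix x y assume xy: "x \<in> Q" "y \<in> Q"
  show "descendent (\<diamondop>) (A ^^ l) ((A ^^ k) x) ((A ^^ k) y)
      = (A ^^ k) (descendent (\<diamondop>) (A ^^ l) ((A ^^ k) x) y)"
  proof (cases "k = 0")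
    case False
    then show ?thesis
      using funpow_averaging[OF xy, of "l + k" k] by (simp add: descendent_def funpow_add)
  qed simp
qed (rule funpow_maps_to)

lemma same_rack_descendent_funpow_add:
  "same_rack Q (descendent (\<diamondop>) (A ^^ (k + l)))
     Q (descendent (descendent (\<diamondop>) (A ^^ l)) (A ^^ k))"
proof -
  \<comment> \<open>Both sides translate by \<open>(A ^^ l) ((A ^^ k) x)\<close>, so they agree even
    outside \<open>Q\<close>.\<close>
  have "descendent (descendent (\<diamondop>) (A ^^ l)) (A ^^ k) = descendent (\<diamondop>) (A ^^ (k + l))"
    by (simp add: fun_eq_iff descendent_def funpow_add add.commute[of k l])
  then show ?thesis
    using averaging_operator.rack_descendent[OF averaging_operator_funpow, of "k + l"]
    by (simp add: same_rack_def)
qed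

end

theorem proposition3p9:
  fixes Q :: "'a set" and opn :: "'a \<Rightarrow> 'a \<Rightarrow> 'a" and A :: "'a \<Rightarrow> 'a"
  assumes "rack Q opn" and "averaging_operator Q opn A"
  shows "(\<forall>k. averaging_operator Q opn (A ^^ k))
    \<and> (\<forall>k l. averaging_operator Q (descendent opn (A ^^ l)) (A ^^ k))
    \<and> (\<forall>k l. same_rack Q (descendent opn (A ^^ (k + l)))
                       Q (descendent (descendent opn (A ^^ l)) (A ^^ k)))"
  using averaging_operator.averaging_operator_funpow[OF assms(2)]
    averaging_operator.averaging_operator_descendent_funpow[OF assms(2)]
    averaging_operator.same_rack_descendent_funpow_add[OF assms(2)]
  by blast

end
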